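(* Let $n$ be a positive integer and let $S$ be a set of $2n+1$ points in the plane in general position (no three collinear and no four concyclic). Then $S$ has exactly $n^2$ halving circles.
   Context: A circle is called halving with respect to a set $S$ of $2n+1$ points if it passes through exactly three points of $S$, has exactly $n-1$ points of $S$ in its interior, and has exactly $n-1$ points of $S$ in its exterior. Circles are counted as distinct subsets of the plane; equivalently, since no four points of $S$ are concyclic, one counts the $3$-element subsets $\{X,Y,Z\}\subseteq S$ whose circumcircle is halving. *)

theory Defs
  imports "HOL-Analysis.Analysis"
begin

definition concyclic :: "(real ^ 2) set \<Rightarrow> bool" where
  "concyclic T \<longleftrightarrow> (\<exists>c r. r > 0 \<and> T \<subseteq> sphere c r)"

definition general_position :: "(real ^ 2) set \<Rightarrow> bool" where
  "general_position S \<longleftrightarrow>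
     (\<forall>T\<subseteq>S. card T = 3 \<longrightarrow> \<not> collinear T) \<and>
     (\<forall>T\<subseteq>S. card T = 4 \<longrightarrow> \<not> concyclic T)"

text \<open>A circle is the subset \<open>sphere c r\<close> of the plane with \<open>r > 0\<close>; its interior is
  \<open>ball c r\<close> and its exterior is the complement of \<open>cball c r\<close>.  The parameter \<open>n\<close> is the
  one with \<open>card S = 2 * n + 1\<close>; for \<open>n \<ge> 1\<close> the subtraction does not truncate.\<close>

definition halving_circle :: "nat \<Rightarrow> (real ^ 2) set \<Rightarrow> (real ^ 2) set \<Rightarrow> bool" where
  "halving_circle n S C \<longleftrightarrow>
     (\<exists>c r. r > 0 \<and> C = sphere c r \<and>
        card (S \<inter> sphere c r) = 3 \<and>
        card (S \<inter> ball c r) = n - 1 \<and>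
        card (S - cball c r) = n - 1)"

end

theory Submission
  imports Defs
begin

text \<open>Order \<open>S\<close> by a linear functional that is injective on \<open>S\<close>, and sort the halving circles by
  the middle one, \<open>v\<close>, of their three points. Inversion at \<open>v\<close> turns those with middle point \<open>v\<close>
  into lines halving the other \<open>2 * n\<close> points and passing through one point on each side of a line
  \<open>\<ell>\<close> through \<open>v\<close>. If \<open>a\<close> and \<open>b\<close> points lie on the two sides of \<open>\<ell>\<close>, then there are exactly
  \<open>min a b\<close> such lines: one for each admissible number of points of the first side lying above
  the line. As \<open>v\<close> runs through \<open>S\<close>, \<open>a\<close> takes each of the values \<open>0, \<dots>, 2 * n\<close> once, and the
  numbers \<open>min a (2 * n - a)\<close> add up to \<open>n ^ 2\<close>.\<close>

section \<open>Points above, on and below a level\<close>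

lemma card_ge_eq_Suc_card_gt:
  fixes h :: "'a \<Rightarrow> 'b::linorder"
  assumes "finite A" "card {i\<in>A. h i = c} = 1"
  shows "card {i\<in>A. c \<le> h i} = Suc (card {i\<in>A. c < h i})"
    and "card {i\<in>A. h i \<le> c} = Suc (card {i\<in>A. h i < c})"
proof -
  have "{i\<in>A. c \<le> h i} = {i\<in>A. c < h i} \<union> {i\<in>A. h i = c}"
    and "{i\<in>A. h i \<le> c} = {i\<in>A. h i < c} \<union> {i\<in>A. h i = c}"
    by auto
  moreover have "card ({i\<in>A. c < h i} \<union> {i\<in>A. h i = c}) = card {i\<in>A. c < h i} + 1"
    and "card ({i\<in>A. h i < c} \<union> {i\<in>A. h i = c}) = card {i\<in>A. h i < c} + 1"
    using assms by (subst card_Un_disjoint; auto)+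
  ultimately show "card {i\<in>A. c \<le> h i} = Suc (card {i\<in>A. c < h i})"
    and "card {i\<in>A. h i \<le> c} = Suc (card {i\<in>A. h i < c})"
    by simp_all
qed

lemma card_trichotomy:
  fixes h :: "'a \<Rightarrow> 'b::linorder"
  assumes "finite A"
  shows "card {i\<in>A. c < h i} + card {i\<in>A. h i = c} + card {i\<in>A. h i < c} = card A"
proof -
  have "A = ({i\<in>A. c < h i} \<union> {i\<in>A. h i = c}) \<union> {i\<in>A. h i < c}"
    by auto
  then have "card A = card (({i\<in>A. c < h i} \<union> {i\<in>A. h i = c}) \<union> {i\<in>A. h i < c})"
    by simp
  also have "\<dots> = card ({i\<in>A. c < h i} \<union> {i\<in>A. h i = c}) + card {i\<in>A. h i < c}"
    using assms by (intro card_Un_disjoint) auto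
  also have "card ({i\<in>A. c < h i} \<union> {i\<in>A. h i = c}) = card {i\<in>A. c < h i} + card {i\<in>A. h i = c}"
    using assms by (intro card_Un_disjoint) auto
  finally show ?thesis by simp
qed

lemma card_Collect_Un_disjoint:
  assumes "finite A" "finite B" "A \<inter> B = {}"
  shows "card {i\<in>A \<union> B. P i} = card {i\<in>A. P i} + card {i\<in>B. P i}"
proof -
  have "{i\<in>A \<union> B. P i} = {i\<in>A. P i} \<union> {i\<in>B. P i}"
    by auto
  then show ?thesis
    using assms by (simp add: card_Un_disjoint disjoint_iff)
qed

section \<open>Lines through one point on each side of the axis \<open>x = 0\<close>\<close>

text \<open>Read \<open>y i - m * x i\<close> as the height at which the line of slope
  \<open>m\<close> through the point \<open>i\<close> meets the axis \<open>x = 0\<close>. A larger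
  slope raises these heights on \<open>A\<close> and lowers them on \<open>B\<close>, so for
  \<open>m < m'\<close> the counts on \<open>A\<close> force \<open>c < c'\<close> while those on
  \<open>B\<close> force \<open>c' < c\<close>.\<close>

lemma splitting_line_slope_le:
  fixes x y :: "'a \<Rightarrow> real"
  assumes fin: "finite A" "finite B"
    and neg: "\<And>i. i \<in> A \<Longrightarrow> x i < 0" and pos: "\<And>i. i \<in> B \<Longrightarrow> 0 < x i"
    and on: "card {i\<in>A. y i - m * x i = c} = 1" "card {i\<in>B. y i - m * x i = c} = 1"
    and A: "card {i\<in>A. c' < y i - m' * x i} = card {i\<in>A. c < y i - m * x i}"
    and B: "card {i\<in>B. y i - m' * x i < c'} = card {i\<in>B. y i - m * x i < c}"
  shows "m' \<le> m"
proof (rule ccontr)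
  assume "\<not> m' \<le> m"
  then have mm': "m < m'" by simp
  have "\<not> {i\<in>A. c \<le> y i - m * x i} \<subseteq> {i\<in>A. c' < y i - m' * x i}"
    using card_mono[of "{i\<in>A. c' < y i - m' * x i}" "{i\<in>A. c \<le> y i - m * x i}"]
      card_ge_eq_Suc_card_gt(1)[OF fin(1) on(1)] fin A by auto
  then obtain i where i: "i \<in> A" "c \<le> y i - m * x i" "y i - m' * x i \<le> c'"
    by force
  have "\<not> {i\<in>B. y i - m * x i \<le> c} \<subseteq> {i\<in>B. y i - m' * x i < c'}"
    using card_mono[of "{i\<in>B. y i - m' * x i < c'}" "{i\<in>B. y i - m * x i \<le> c}"]
      card_ge_eq_Suc_card_gt(2)[OF fin(2) on(2)] fin B by auto
  then obtain j where j: "j \<in> B" "y j - m * x j \<le> c" "c' \<le> y j - m' * x j"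
    by force
  have "m' * x i < m * x i"
    using mm' neg[OF i(1)] by (simp add: mult_strict_right_mono_neg)
  moreover have "m * x j < m' * x j"
    using mm' pos[OF j(1)] by (simp add: mult_strict_right_mono)
  ultimately show False
    using i j by linarith
qed

text \<open>Comparing in both directions gives equal slopes. At one slope, two different levels,
  each through a point of \<open>A\<close>, have different numbers of points of \<open>A\<close>
  above them.\<close>

lemma splitting_line_unique:
  fixes x y :: "'a \<Rightarrow> real"
  assumes fin: "finite A" "finite B"
    and neg: "\<And>i. i \<in> A \<Longrightarrow> x i < 0" and pos: "\<And>i. i \<in> B \<Longrightarrow> 0 < x i"
    and on: "card {i\<in>A. y i - m * x i = c} = 1" "card {i\<in>B. y i - m * x i = c} = 1"
    and on': "card {i\<in>A. y i - m' * x i = c'} = 1" "card {i\<in>B. y i - m' * x i = c'} = 1"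
    and A: "card {i\<in>A. c < y i - m * x i} = card {i\<in>A. c' < y i - m' * x i}"
    and B: "card {i\<in>B. y i - m * x i < c} = card {i\<in>B. y i - m' * x i < c'}"
  shows "m = m' \<and> c = c'"
proof -
  have m: "m = m'"
    using splitting_line_slope_le[where x=x and y=y, OF fin neg pos on A[symmetric] B[symmetric]]
      splitting_line_slope_le[where x=x and y=y, OF fin neg pos on' A B] by simp
  have le: "c' \<le> c" if "card {i\<in>A. y i - m * x i = c'} = 1"
    "card {i\<in>A. c < y i - m * x i} = card {i\<in>A. c' < y i - m * x i}" for c c'
  proof (rule ccontr)
    assume "\<not> c' \<le> c"
    then have "{i\<in>A. c' \<le> y i - m * x i} \<subseteq> {i\<in>A. c < y i - m * x i}"
      by auto
    then show False
      using card_mono[of "{i\<in>A. c < y i - m * x i}" "{i\<in>A. c' \<le> y i - m * x i}"] fin(1)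
        card_ge_eq_Suc_card_gt(1)[OF fin(1) that(1)] that(2) by auto
  qed
  show ?thesis
    using m le[of c' c] le[of c c'] on(1) on'(1) A by auto
qed

text \<open>The \<open>k\<close>-th highest point of \<open>A\<close> rises and the \<open>l\<close>-th lowest point of \<open>B\<close> falls as the slope
  grows, so their heights agree at exactly one slope. That slope is the minimum, over
  \<open>k\<close>-subsets \<open>T\<close> of \<open>A\<close> and \<open>l\<close>-subsets \<open>U\<close> of \<open>B\<close>, of the slope from which on \<open>T\<close> lies above \<open>U\<close>.\<close>

lemma splitting_line_exists:
  fixes x y :: "'a \<Rightarrow> real"
  assumes fin: "finite A" "finite B"
    and neg: "\<And>i. i \<in> A \<Longrightarrow> x i < 0" and pos: "\<And>i. i \<in> B \<Longrightarrow> 0 < x i"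
    and gen: "\<And>m c. card {i\<in>A \<union> B. y i - m * x i = c} \<le> 2"
    and k: "k < card A" and l: "l < card B"
  shows "\<exists>m c. card {i\<in>A. y i - m * x i = c} = 1 \<and> card {i\<in>B. y i - m * x i = c} = 1 \<and>
    card {i\<in>A. c < y i - m * x i} = k \<and> card {i\<in>B. y i - m * x i < c} = l"
proof -
  \<comment> \<open>\<open>s i j\<close> is the slope from which on \<open>i\<close> is at least as
    high as \<open>j\<close>; below, \<open>g (T, U)\<close> is the slope from which on all of
    \<open>T\<close> is at least as high as all of \<open>U\<close>.\<close>
  define s where "s i j = (y j - y i) / (x j - x i)" for i j
  have s_le: "s i j \<le> m \<longleftrightarrow> y j - m * x j \<le> y i - m * x i"
    and s_less: "s i j < m \<longleftrightarrow> y j - m * x j < y i - m * x i" if "i \<in> A" "j \<in> B" for i j m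
    using neg[OF that(1)] pos[OF that(2)]
    by (auto simp: s_def pos_divide_le_eq pos_divide_less_eq algebra_simps)
  define F where "F = {T. T \<subseteq> A \<and> card T = Suc k} \<times> {U. U \<subseteq> B \<and> card U = Suc l}"
  define g where "g = (\<lambda>(T, U). Max (case_prod s ` (T \<times> U)))"
  have finF: "finite F"
    using fin by (auto simp: F_def)
  obtain T0 U0 where "T0 \<subseteq> A" "card T0 = Suc k" "U0 \<subseteq> B" "card U0 = Suc l"
    using obtain_subset_with_card_n[of "Suc k" A] obtain_subset_with_card_n[of "Suc l" B] k l
    by (metis Suc_leI)
  then have "F \<noteq> {}"
    by (auto simp: F_def)
  define m where "m = Min (g ` F)"
  have "m \<in> g ` F"
    using finF \<open>F \<noteq> {}\<close> by (auto simp: m_def intro!: Min_in)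
  then obtain T U where TU: "T \<subseteq> A" "card T = Suc k" "U \<subseteq> B" "card U = Suc l" "g (T, U) = m"
    by (auto simp: F_def)
  have finTU: "finite T" "finite U"
    using TU fin finite_subset by blast+
  have neTU: "T \<noteq> {}" "U \<noteq> {}"
    using TU by auto
  have "m \<in> case_prod s ` (T \<times> U)"
  proof -
    have "Max (case_prod s ` (T \<times> U)) \<in> case_prod s ` (T \<times> U)"
      using finTU neTU by (intro Max_in) auto
    then show ?thesis
      using TU(5) by (simp add: g_def)
  qed
  then obtain i j where ij: "i \<in> T" "j \<in> U" "s i j = m"
    by auto
  have le_m: "s p q \<le> m" if "p \<in> T" "q \<in> U" for p q
  proof -
    have "s p q \<le> Max (case_prod s ` (T \<times> U))"
      using that finTU by (intro Max_ge) force+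
    then show ?thesis
      using TU(5) by (simp add: g_def)
  qed
  \<comment> \<open>Minimality of \<open>m\<close>: at slope \<open>m\<close>, no
    \<open>Suc k\<close> points of \<open>A\<close> all lie strictly above \<open>Suc l\<close>
    points of \<open>B\<close>.\<close>
  have not_less: "\<exists>p\<in>T'. \<exists>q\<in>U'. m \<le> s p q"
    if "T' \<subseteq> A" "card T' = Suc k" "U' \<subseteq> B" "card U' = Suc l" for T' U'
  proof (rule ccontr)
    assume "\<not> ?thesis"
    then have lt: "\<And>p q. p \<in> T' \<Longrightarrow> q \<in> U' \<Longrightarrow> s p q < m"
      by force
    have "finite T'" "finite U'" "T' \<noteq> {}" "U' \<noteq> {}"
      using that fin finite_subset by (blast, blast, auto)
    then have "g (T', U') < m"
      using lt unfolding g_def by (subst case_prod_conv, subst Max_less_iff) auto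
    moreover have "m \<le> g (T', U')"
      using that finF unfolding m_def by (intro Min_le) (auto simp: F_def)
    ultimately show False by simp
  qed
  define h where "h p = y p - m * x p" for p
  \<comment> \<open>The extremal pair \<open>i\<close>, \<open>j\<close> meets at slope
    \<open>m\<close>; its common height is the level sought.\<close>
  define c where "c = h i"
  have iA: "i \<in> A" and jB: "j \<in> B"
    using ij TU by auto
  have disj: "A \<inter> B = {}"
    using neg pos by force
  have hj: "h j = c"
    using s_le[OF iA jB, of m] s_less[OF iA jB, of m] ij(3) by (auto simp: c_def h_def)
  have "{p\<in>A \<union> B. h p = c} = {i, j}"
  proof (rule sym, rule card_subset_eq)
    show "{i, j} \<subseteq> {p\<in>A \<union> B. h p = c}"
      using iA jB hj by (auto simp: c_def)
    show "card {i, j} = card {p\<in>A \<union> B. h p = c}"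
    proof (rule antisym)
      show "card {i, j} \<le> card {p\<in>A \<union> B. h p = c}"
        using \<open>{i, j} \<subseteq> _\<close> fin by (intro card_mono) auto
      have "card {i, j} = 2"
        using iA jB disj by (auto simp: card_insert_if)
      then show "card {p\<in>A \<union> B. h p = c} \<le> card {i, j}"
        using gen[of m c] by (simp add: h_def)
    qed
  qed (use fin in auto)
  then have onA: "{p\<in>A. h p = c} = {i}" and onB: "{p\<in>B. h p = c} = {j}"
    using iA jB disj by auto
  have T_ge: "T \<subseteq> {p\<in>A. c \<le> h p}"
    using le_m[OF _ ij(2)] s_le[OF _ jB] TU(1) hj by (auto simp: h_def)
  have U_le: "U \<subseteq> {p\<in>B. h p \<le> c}"
    using le_m[OF ij(1)] s_le[OF iA] TU(3) by (auto simp: h_def c_def)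
  have cards: "card {p\<in>A. c \<le> h p} = Suc (card {p\<in>A. c < h p})"
    "card {p\<in>B. h p \<le> c} = Suc (card {p\<in>B. h p < c})"
    using card_ge_eq_Suc_card_gt(1)[OF fin(1), of h c] card_ge_eq_Suc_card_gt(2)[OF fin(2), of h c] onA onB
    by simp_all
  have "k \<le> card {p\<in>A. c < h p}"
    using card_mono[OF _ T_ge] fin TU(2) cards by simp
  \<comment> \<open>\<open>Suc k\<close> points of \<open>A\<close> strictly above \<open>c\<close>
    would lie strictly above \<open>U\<close>, against the minimality of \<open>m\<close>. The bound
    on \<open>B\<close> is symmetric.\<close>
  moreover have "\<not> Suc k \<le> card {p\<in>A. c < h p}"
  proof
    assume "Suc k \<le> card {p\<in>A. c < h p}"
    then obtain T' where T': "T' \<subseteq> {p\<in>A. c < h p}" "card T' = Suc k"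
      by (meson obtain_subset_with_card_n)
    then obtain p q where pq: "p \<in> T'" "q \<in> U" "m \<le> s p q"
      using not_less[of T' U] TU by auto
    then have "h p \<le> h q"
      using s_less[of p q m] T'(1) TU(3) pq(1,2) linorder_not_less by (fastforce simp: h_def)
    then show False
      using pq(1,2) T'(1) U_le by fastforce
  qed
  moreover have "l \<le> card {p\<in>B. h p < c}"
    using card_mono[OF _ U_le] fin TU(4) cards by simp
  moreover have "\<not> Suc l \<le> card {p\<in>B. h p < c}"
  proof
    assume "Suc l \<le> card {p\<in>B. h p < c}"
    then obtain U' where U': "U' \<subseteq> {p\<in>B. h p < c}" "card U' = Suc l"
      by (meson obtain_subset_with_card_n)
    then obtain p q where pq: "p \<in> T" "q \<in> U'" "m \<le> s p q"
      using not_less[of T U'] TU by auto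
    then have "h p \<le> h q"
      using s_less[of p q m] U'(1) TU(1) pq(1,2) linorder_not_less by (fastforce simp: h_def)
    then show False
      using pq(1,2) U'(1) T_ge by fastforce
  qed
  ultimately show ?thesis
    using onA onB by (intro exI[of _ m] exI[of _ c]) (auto simp: h_def)
qed

text \<open>The number of points of \<open>A\<close> above such a line fixes the other counts, so by
  uniqueness and existence it parametrises the lines. What remains is to find its range.\<close>

lemma card_halving_lines_across:
  fixes x y :: "'a \<Rightarrow> real"
  assumes fin: "finite A" "finite B"
    and neg: "\<And>i. i \<in> A \<Longrightarrow> x i < 0" and pos: "\<And>i. i \<in> B \<Longrightarrow> 0 < x i"
    and gen: "\<And>m c. card {i\<in>A \<union> B. y i - m * x i = c} \<le> 2"
    and n: "n \<ge> 1" and card: "card A + card B = 2 * n"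
  defines "L \<equiv> {(m, c). card {i\<in>A. y i - m * x i = c} = 1 \<and> card {i\<in>B. y i - m * x i = c} = 1 \<and>
    card {i\<in>A \<union> B. c < y i - m * x i} = n - 1}"
  shows "finite L" and "card L = min (card A) (card B)"
proof -
  have disj: "A \<inter> B = {}"
    using neg pos by force
  note Un = card_Collect_Un_disjoint[OF fin disj]
  define a where "a = (\<lambda>(m, c). card {i\<in>A. c < y i - m * x i})"
  \<comment> \<open>Stated as a sum to avoid truncation: with \<open>k = a (m, c)\<close>, there are
    \<open>n - 1 - k\<close> points of \<open>B\<close> above the line and one on it, which leaves
    \<open>card B + k - n\<close> below.\<close>
  have below: "card {i\<in>B. y i - m * x i < c} + n = card B + a (m, c)"
    and a_bounds: "a (m, c) < card A" "a (m, c) < n" "n \<le> card B + a (m, c)"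
    if "(m, c) \<in> L" for m c
  proof -
    have "a (m, c) + card {i\<in>B. c < y i - m * x i} = n - 1"
      using that[unfolded L_def] Un[of "\<lambda>i. c < y i - m * x i"] by (simp add: a_def)
    moreover have "card {i\<in>B. c < y i - m * x i} + 1 + card {i\<in>B. y i - m * x i < c} = card B"
      using card_trichotomy[OF fin(2), of c "\<lambda>i. y i - m * x i"] that[unfolded L_def] by simp
    moreover have "a (m, c) + 1 + card {i\<in>A. y i - m * x i < c} = card A"
      using card_trichotomy[OF fin(1), of c "\<lambda>i. y i - m * x i"] that[unfolded L_def] by (simp add: a_def)
    ultimately show "card {i\<in>B. y i - m * x i < c} + n = card B + a (m, c)"
      "a (m, c) < card A" "a (m, c) < n" "n \<le> card B + a (m, c)"
      using n by linarith+
  qed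
  \<comment> \<open>The lower bound says that the count of \<open>B\<close> below is nonnegative;
    truncation makes it 0 when \<open>card B \<ge> n\<close>.\<close>
  have bij: "bij_betw a L {n - card B..<min (card A) n}"
    unfolding bij_betw_def
  proof (intro conjI inj_onI equalityI subsetI)
    fix P Q assume P: "P \<in> L" and Q: "Q \<in> L" and aPQ: "a P = a Q"
    obtain m c m' c' where PQ: "P = (m, c)" "Q = (m', c')"
      by (cases P, cases Q)
    have "m = m' \<and> c = c'"
    proof (rule splitting_line_unique[where x=x and y=y, OF fin neg pos])
      show "card {i\<in>B. y i - m * x i < c} = card {i\<in>B. y i - m' * x i < c'}"
        using below[of m c] below[of m' c'] P Q PQ aPQ by simp
    qed (use P Q PQ aPQ in \<open>auto simp: a_def L_def\<close>)
    then show "P = Q"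
      using PQ by simp
  next
    fix k assume "k \<in> a ` L"
    then show "k \<in> {n - card B..<min (card A) n}"
      using a_bounds by fastforce
  next
    fix k assume k: "k \<in> {n - card B..<min (card A) n}"
    then have "k < card A" "card B + k - n < card B"
      using n by auto
    from splitting_line_exists[where x=x and y=y, OF fin neg pos gen this]
    obtain m c where mc: "card {i\<in>A. y i - m * x i = c} = 1" "card {i\<in>B. y i - m * x i = c} = 1"
      "card {i\<in>A. c < y i - m * x i} = k" "card {i\<in>B. y i - m * x i < c} = card B + k - n"
      by blast
    have "card {i\<in>A \<union> B. c < y i - m * x i} = n - 1"
      using card_trichotomy[OF fin(2), of c "\<lambda>i. y i - m * x i"] mc k Un[of "\<lambda>i. c < y i - m * x i"]
      by auto
    then show "k \<in> a ` L"
      using mc by (intro image_eqI[of _ _ "(m, c)"]) (auto simp: a_def L_def)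
  qed
  then show "finite L"
    using bij_betw_finite by blast
  from bij have "card L = min (card A) n - (n - card B)"
    by (simp add: bij_betw_same_card)
  \<comment> \<open>Since the cardinalities add up to \<open>2 * n\<close>, the interval is
    \<open>{0..<card A}\<close> if \<open>card A \<le> n\<close> and \<open>{n - card B..<n}\<close>
    otherwise.\<close>
  also have "\<dots> = min (card A) (card B)"
    using card by auto
  finally show "card L = min (card A) (card B)" .
qed

section \<open>Inversion and a generic coordinate system\<close>

text \<open>A circle through \<open>v\<close> with centre \<open>v + D\<close> becomes the line \<open>2 * (X \<bullet> D) = 1\<close> under the
  inversion \<open>X = (p - v) /\<^sub>R (norm (p - v))\<^sup>2\<close>.\<close>

lemma dist_less_norm_iff_inversion:
  fixes p v D :: "'a::real_inner"
  assumes "p \<noteq> v"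
  shows "dist (v + D) p < norm D \<longleftrightarrow> 1 < 2 * (((p - v) /\<^sub>R (norm (p - v))\<^sup>2) \<bullet> D)"
    and "dist (v + D) p = norm D \<longleftrightarrow> 2 * (((p - v) /\<^sub>R (norm (p - v))\<^sup>2) \<bullet> D) = 1"
proof -
  define q where "q = p - v"
  have q: "q \<noteq> 0"
    using assms by (simp add: q_def)
  have d: "dist (v + D) p = norm (q - D)"
    by (simp add: dist_norm q_def norm_minus_commute algebra_simps)
  have sq: "(norm (q - D))\<^sup>2 = (norm q)\<^sup>2 - 2 * (q \<bullet> D) + (norm D)\<^sup>2"
    by (simp add: power2_norm_eq_inner inner_diff inner_commute)
  have "norm (q - D) < norm D \<longleftrightarrow> (norm (q - D))\<^sup>2 < (norm D)\<^sup>2"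
    by (metis norm_ge_zero power2_less_imp_less power_strict_mono zero_less_numeral)
  then show "dist (v + D) p < norm D \<longleftrightarrow> 1 < 2 * (((p - v) /\<^sub>R (norm (p - v))\<^sup>2) \<bullet> D)"
    using q unfolding d sq q_def[symmetric] by (simp add: field_simps)
  have "norm (q - D) = norm D \<longleftrightarrow> (norm (q - D))\<^sup>2 = (norm D)\<^sup>2"
    by simp
  then show "dist (v + D) p = norm D \<longleftrightarrow> 2 * (((p - v) /\<^sub>R (norm (p - v))\<^sup>2) \<bullet> D) = 1"
    using q unfolding d sq q_def[symmetric] by (simp add: field_simps)
qed

lemma collinear_if_inner_const:
  fixes z :: "real ^ 2"
  assumes "z \<noteq> 0" "\<And>p. p \<in> T \<Longrightarrow> z \<bullet> p = d"
  shows "collinear T"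
proof -
  have "aff_dim T \<le> aff_dim {p. z \<bullet> p = d}"
    using assms by (intro aff_dim_subset) auto
  then show ?thesis
    using assms(1) by (simp add: collinear_aff_dim aff_dim_hyperplane)
qed

text \<open>Supplies the functional that orders \<open>S\<close> and coordinates for the inverted
  plane: the orthogonal vectors \<open>(1, t)\<close> and \<open>(-t, 1)\<close>, with
  \<open>t\<close> outside a finite set.\<close>

lemma exists_generic_basis:
  fixes S :: "(real ^ 2) set"
  assumes "finite S"
  obtains u w where "inj_on (\<lambda>p. p \<bullet> u) S" "\<And>m. w - m *\<^sub>R u \<noteq> 0"
    "\<And>D. \<exists>\<alpha> \<beta>. D = \<alpha> *\<^sub>R u + \<beta> *\<^sub>R w"
proof -
  \<comment> \<open>The values of \<open>t\<close> at which two points with different second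
    coordinates could agree. Pairs with equal second coordinates only contribute 0, by division by
    zero; if distinct, they are separated by every \<open>t\<close>.\<close>
  define Z where "Z = (\<lambda>(p, q). (q $ 1 - p $ 1) / (p $ 2 - q $ 2)) ` (S \<times> S)"
  have "finite Z"
    using assms by (simp add: Z_def)
  then obtain t where t: "t \<notin> Z"
    using ex_new_if_finite infinite_UNIV_char_0 by blast
  have pos: "1 + t\<^sup>2 > 0"
    by (simp add: add_pos_nonneg)
  show ?thesis
  proof
    show "inj_on (\<lambda>p. p \<bullet> vector [1, t]) S"
    proof (rule inj_onI)
      fix p q assume pq: "p \<in> S" "q \<in> S" "p \<bullet> vector [1, t] = q \<bullet> vector [1, t]"
      then have eq: "p $ 1 + p $ 2 * t = q $ 1 + q $ 2 * t"
        by (simp add: inner_vec_def sum_2)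
      have "p $ 2 = q $ 2"
      proof (rule ccontr)
        assume "p $ 2 \<noteq> q $ 2"
        then have "t = (q $ 1 - p $ 1) / (p $ 2 - q $ 2)"
          using eq by (simp add: field_simps)
        then show False
          using t pq by (auto simp: Z_def)
      qed
      then show "p = q"
        using eq by (simp add: vec_eq_iff forall_2)
    qed
    show "vector [- t, 1] - m *\<^sub>R vector [1, t] \<noteq> (0 :: real ^ 2)" for m
    proof
      assume "vector [- t, 1] - m *\<^sub>R vector [1, t] = (0 :: real ^ 2)"
      then have "m = - t" "m * t = 1"
        by (simp_all add: vec_eq_iff forall_2)
      then show False
        using pos by (simp add: power2_eq_square)
    qed
    fix D :: "real ^ 2"
    define \<alpha> \<beta> where "\<alpha> = (D $ 1 + t * D $ 2) / (1 + t\<^sup>2)" and "\<beta> = (D $ 2 - t * D $ 1) / (1 + t\<^sup>2)"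
    have "\<alpha> - t * \<beta> = ((D $ 1 + t * D $ 2) - t * (D $ 2 - t * D $ 1)) / (1 + t\<^sup>2)"
      and "t * \<alpha> + \<beta> = (t * (D $ 1 + t * D $ 2) + (D $ 2 - t * D $ 1)) / (1 + t\<^sup>2)"
      by (simp_all add: \<alpha>_def \<beta>_def diff_divide_distrib[symmetric] add_divide_distrib[symmetric])
    moreover have "(D $ 1 + t * D $ 2) - t * (D $ 2 - t * D $ 1) = D $ 1 * (1 + t\<^sup>2)"
      and "t * (D $ 1 + t * D $ 2) + (D $ 2 - t * D $ 1) = D $ 2 * (1 + t\<^sup>2)"
      by algebra+
    ultimately have "D $ 1 = \<alpha> - t * \<beta>" "D $ 2 = t * \<alpha> + \<beta>"
      using pos by simp_all
    then show "\<exists>\<alpha> \<beta>. D = \<alpha> *\<^sub>R vector [1, t] + \<beta> *\<^sub>R vector [- t, 1]"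
      by (intro exI[of _ \<alpha>] exI[of _ \<beta>]) (simp add: vec_eq_iff forall_2 mult.commute)
  qed
qed

section \<open>Halving circles with a given middle point\<close>

text \<open>Inversion at \<open>v\<close> keeps \<open>A\<close> and \<open>B\<close> on their sides
  of the axis and carries the circles in \<open>H\<close> bijectively to the lines of
  \<open>card_halving_lines_across\<close>. General position rules out lines with
  \<open>c = 0\<close>, and having a point on each side rules out vertical lines.\<close>

lemma card_halving_circles_middle:
  fixes S :: "(real ^ 2) set" and u w v :: "real ^ 2"
  assumes gp: "general_position S" and n: "n \<ge> 1" and card: "card S = 2 * n + 1"
    and inj: "inj_on (\<lambda>p. p \<bullet> u) S" and indep: "\<And>m. w - m *\<^sub>R u \<noteq> 0"
    and span: "\<And>D. \<exists>\<alpha> \<beta>. D = \<alpha> *\<^sub>R u + \<beta> *\<^sub>R w" and v: "v \<in> S"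
  defines "A \<equiv> {p\<in>S. p \<bullet> u < v \<bullet> u}" and "B \<equiv> {p\<in>S. v \<bullet> u < p \<bullet> u}"
  defines "H \<equiv> {C. halving_circle n S C \<and> v \<in> C \<and> card (A \<inter> C) = 1 \<and> card (B \<inter> C) = 1}"
  shows "finite H" and "card H = min (card A) (card B)"
proof -
  have finS: "finite S"
    by (intro card_ge_0_finite) (simp add: card)
  then have fin: "finite A" "finite B"
    by (simp_all add: A_def B_def)
  have AB: "A \<union> B = S - {v}"
    using inj_onD[OF inj _ _ v] by (auto simp: A_def B_def not_less order.order_iff_strict)
  have disj: "A \<inter> B = {}"
    by (auto simp: A_def B_def)
  have "card A + card B = card (S - {v})"
    using card_Un_disjoint[OF fin disj] AB by simp
  then have cardAB: "card A + card B = 2 * n"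
    using card v finS by simp
  define X where "X p = (p - v) /\<^sub>R (norm (p - v))\<^sup>2" for p
  define x where "x p = X p \<bullet> u" for p
  define y where "y p = X p \<bullet> w" for p
  have normpos: "0 < (norm (p - v))\<^sup>2" if "p \<in> A \<union> B" for p
    using that AB by simp
  have neg: "x p < 0" if "p \<in> A" for p
    using that normpos[of p]
    by (simp add: x_def X_def A_def inner_diff_left mult_pos_neg)
  have pos: "0 < x p" if "p \<in> B" for p
    using that normpos[of p]
    by (simp add: x_def X_def B_def inner_diff_left)
  \<comment> \<open>Chosen so that \<open>2 * (X p \<bullet> D m c) = 1\<close> is the line
    \<open>y p - m * x p = c\<close>. The sign of \<open>c\<close> decides whether the interior of
    the circle becomes the side above or below that line.\<close>
  define D where "D m c = (1 / (2 * c)) *\<^sub>R (w - m *\<^sub>R u)" for m c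
  have Dpos: "0 < norm (D m c)" if "c \<noteq> 0" for m c
    using that indep[of m] by (simp add: D_def)
  have XD: "2 * (X p \<bullet> D m c) = (y p - m * x p) / c" for p m c
    by (simp add: D_def x_def y_def inner_diff_right diff_divide_distrib right_diff_distrib)
  have less: "dist (v + D m c) p < norm (D m c) \<longleftrightarrow> (if 0 < c then c < y p - m * x p else y p - m * x p < c)"
    and eq: "dist (v + D m c) p = norm (D m c) \<longleftrightarrow> y p - m * x p = c"
    if "p \<in> A \<union> B" "c \<noteq> 0" for p m c
  proof -
    have "p \<noteq> v"
      using that(1) AB by auto
    note inversion = dist_less_norm_iff_inversion[OF this, of "D m c", folded X_def, unfolded XD]
    show "dist (v + D m c) p < norm (D m c) \<longleftrightarrow> (if 0 < c then c < y p - m * x p else y p - m * x p < c)"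
      using that(2) unfolding inversion(1) less_divide_eq_1 by auto
    show "dist (v + D m c) p = norm (D m c) \<longleftrightarrow> y p - m * x p = c"
      using that(2) unfolding inversion(2) by auto
  qed
  have le: "dist (v + D m c) p \<le> norm (D m c) \<longleftrightarrow> (if 0 < c then c \<le> y p - m * x p else y p - m * x p \<le> c)"
    if "p \<in> A \<union> B" "c \<noteq> 0" for p m c
    unfolding order.order_iff_strict less[OF that] eq[OF that] by auto
  have on_Int: "T \<inter> sphere (v + D m c) (norm (D m c)) = {p\<in>T. y p - m * x p = c}"
    if "T \<subseteq> A \<union> B" "c \<noteq> 0" for T m c
    using that eq by (auto simp: subset_iff)
  have on_v: "dist (v + D m c) v = norm (D m c)" for m c
    by (simp add: dist_norm)
  \<comment> \<open>At \<open>c = 0\<close> the line passes through the centre of inversion and is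
    its own inverse, so its points are collinear with \<open>v\<close>.\<close>
  have on_line_0: "collinear (insert v {p\<in>A \<union> B. y p - m * x p = 0})" for m
  proof (rule collinear_if_inner_const[OF indep[of m]])
    fix p assume "p \<in> insert v {p\<in>A \<union> B. y p - m * x p = 0}"
    then consider "p = v" | "p \<in> A \<union> B" "X p \<bullet> (w - m *\<^sub>R u) = 0"
      by (auto simp: x_def y_def inner_diff_right)
    then have "(p - v) \<bullet> (w - m *\<^sub>R u) = 0"
      using normpos by cases (auto simp: X_def)
    then show "(w - m *\<^sub>R u) \<bullet> p = (w - m *\<^sub>R u) \<bullet> v"
      by (simp add: inner_diff_left inner_commute)
  qed
  have le_1: "card {p\<in>A \<union> B. y p - m * x p = 0} \<le> 1" for m
  proof (rule ccontr)
    assume "\<not> ?thesis"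
    then obtain T where T: "T \<subseteq> {p\<in>A \<union> B. y p - m * x p = 0}" "card T = 2" "finite T"
      using obtain_subset_with_card_n[of 2 "{p\<in>A \<union> B. y p - m * x p = 0}"] by auto
    have "v \<notin> T"
      using T(1) AB by auto
    then have "card (insert v T) = 3" "insert v T \<subseteq> S"
      using T AB v by auto
    moreover have "collinear (insert v T)"
      using T(1) by (intro collinear_subset[OF on_line_0[of m]]) auto
    ultimately show False
      using gp by (auto simp: general_position_def)
  qed
  \<comment> \<open>Three points on a line with \<open>c \<noteq> 0\<close> would be concyclic with
    \<open>v\<close>.\<close>
  have gen: "card {p\<in>A \<union> B. y p - m * x p = c} \<le> 2" for m c
  proof (cases "c = 0")
    case True
    then show ?thesis
      using le_1[of m] by simp
  next
    case False
    show ?thesis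
    proof (rule ccontr)
      assume "\<not> ?thesis"
      then obtain T where T: "T \<subseteq> {p\<in>A \<union> B. y p - m * x p = c}" "card T = 3" "finite T"
        using obtain_subset_with_card_n[of 3 "{p\<in>A \<union> B. y p - m * x p = c}"] by auto
      have "v \<notin> T"
        using T(1) AB by auto
      then have "card (insert v T) = 4" "insert v T \<subseteq> S"
        using T AB v by auto
      moreover have "insert v T \<subseteq> sphere (v + D m c) (norm (D m c))"
        using T(1) eq[OF _ False, of _ m] on_v[of m c] by auto
      ultimately show False
        using gp Dpos[OF False, of m] unfolding general_position_def concyclic_def by blast
    qed
  qed
  define L where "L = {(m, c). card {i\<in>A. y i - m * x i = c} = 1 \<and> card {i\<in>B. y i - m * x i = c} = 1 \<and>
    card {i\<in>A \<union> B. c < y i - m * x i} = n - 1}"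
  note L = card_halving_lines_across[where x=x and y=y, OF fin neg pos gen n cardAB, folded L_def]
  have on_AB: "card {i\<in>A \<union> B. y i - m * x i = c} = card {i\<in>A. y i - m * x i = c} + card {i\<in>B. y i - m * x i = c}"
    for m c
    by (rule card_Collect_Un_disjoint[OF fin disj])
  have c0: "c \<noteq> 0" if "(m, c) \<in> L" for m c
    using that le_1[of m] on_AB[of m 0] by (auto simp: L_def)
  have halving: "halving_circle n S (sphere (v + D m c) (norm (D m c)))"
    if on: "card {i\<in>A. y i - m * x i = c} = 1" "card {i\<in>B. y i - m * x i = c} = 1"
      and c: "c \<noteq> 0" and above: "card {i\<in>A \<union> B. c < y i - m * x i} = n - 1" for m c
  proof -
    \<comment> \<open>Of \<open>2 * n\<close> points, two are on the line and \<open>n - 1\<close>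
      above, so \<open>n - 1\<close> are below; hence either sign of \<open>c\<close> gives a
      halving circle.\<close>
    have below: "card {i\<in>A \<union> B. y i - m * x i < c} = n - 1"
      using card_trichotomy[of "A \<union> B" c "\<lambda>i. y i - m * x i"] fin above on on_AB[of m c]
        card_Un_disjoint[OF fin disj] cardAB n by simp
    have S: "S = insert v (A \<union> B)"
      using AB v by auto
    have "S \<inter> sphere (v + D m c) (norm (D m c)) = insert v {i\<in>A \<union> B. y i - m * x i = c}"
      using eq[OF _ c, of _ m] on_v by (auto simp: S)
    moreover have "v \<notin> {i\<in>A \<union> B. y i - m * x i = c}"
      using AB by auto
    ultimately have "card (S \<inter> sphere (v + D m c) (norm (D m c))) = 3"
      using on on_AB[of m c] fin by simp
    moreover have "S \<inter> ball (v + D m c) (norm (D m c)) =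
        (if 0 < c then {i\<in>A \<union> B. c < y i - m * x i} else {i\<in>A \<union> B. y i - m * x i < c})"
      using less[OF _ c, of _ m] on_v by (auto simp: S)
    then have "card (S \<inter> ball (v + D m c) (norm (D m c))) = n - 1"
      using above below by presburger
    moreover have "S - cball (v + D m c) (norm (D m c)) =
        (if 0 < c then {i\<in>A \<union> B. y i - m * x i < c} else {i\<in>A \<union> B. c < y i - m * x i})"
      using le[OF _ c, of _ m] on_v by (auto simp: S)
    then have "card (S - cball (v + D m c) (norm (D m c))) = n - 1"
      using above below by presburger
    ultimately show ?thesis
      using Dpos[OF c, of m] unfolding halving_circle_def by blast
  qed
  define \<Phi> where "\<Phi> = (\<lambda>(m, c). sphere (v + D m c) (norm (D m c)))"
  have "bij_betw \<Phi> L H"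
    unfolding bij_betw_def
  proof (intro conjI inj_onI equalityI subsetI)
    fix P Q assume P: "P \<in> L" and Q: "Q \<in> L" and PhiPQ: "\<Phi> P = \<Phi> Q"
    obtain m c m' c' where PQ: "P = (m, c)" "Q = (m', c')"
      by (cases P, cases Q)
    note mem = P[unfolded PQ] Q[unfolded PQ]
    \<comment> \<open>The circle determines its points in \<open>A\<close> and \<open>B\<close>;
      these have different \<open>x\<close>, so they determine slope and level.\<close>
    have "{i\<in>T. y i - m * x i = c} = {i\<in>T. y i - m' * x i = c'}" if "T \<subseteq> A \<union> B" for T
      using on_Int[OF that c0[OF mem(1)], of m] on_Int[OF that c0[OF mem(2)], of m'] PhiPQ PQ
      by (simp add: \<Phi>_def)
    from this[of A] this[of B]
    have same: "{i\<in>A. y i - m * x i = c} = {i\<in>A. y i - m' * x i = c'}"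
      "{i\<in>B. y i - m * x i = c} = {i\<in>B. y i - m' * x i = c'}"
      by auto
    obtain i j where "{i\<in>A. y i - m * x i = c} = {i}" "{i\<in>B. y i - m * x i = c} = {j}"
      using mem(1) by (auto simp: L_def card_1_singleton_iff)
    then have ij: "i \<in> A" "j \<in> B" "y i - m * x i = c" "y j - m * x j = c"
      "y i - m' * x i = c'" "y j - m' * x j = c'"
      using same by auto
    then have "(m - m') * (x i - x j) = 0"
      by (simp add: algebra_simps)
    then have "m = m'"
      using neg[OF ij(1)] pos[OF ij(2)] by auto
    then show "P = Q"
      using ij PQ by simp
  next
    fix C assume "C \<in> \<Phi> ` L"
    then obtain m c where mc: "(m, c) \<in> L" "C = sphere (v + D m c) (norm (D m c))"
      by (auto simp: \<Phi>_def)
    show "C \<in> H"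
      using halving[of m c] on_Int[of A c m] on_Int[of B c m] c0[OF mc(1)] mc on_v[of m c]
      by (auto simp: L_def H_def)
  next
    fix C assume C: "C \<in> H"
    then obtain z r where zr: "r > 0" "C = sphere z r" "card (S \<inter> ball z r) = n - 1"
      "card (S - cball z r) = n - 1"
      by (auto simp: H_def halving_circle_def)
    have r: "r = norm (z - v)"
      using C[unfolded H_def] zr(2) by (simp add: dist_norm)
    obtain \<alpha> \<beta> where ab: "z - v = \<alpha> *\<^sub>R u + \<beta> *\<^sub>R w"
      using span by blast
    obtain i j where ij: "A \<inter> C = {i}" "B \<inter> C = {j}"
      using C[unfolded H_def] by (auto simp: card_1_singleton_iff)
    have on_C: "2 * (X p \<bullet> (z - v)) = 1" if "p \<in> A \<union> B" "p \<in> C" for p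
      using dist_less_norm_iff_inversion(2)[of p v "z - v"] that AB zr(2) r by (auto simp: X_def)
    \<comment> \<open>For \<open>\<beta> = 0\<close> the line would be vertical,
      \<open>2 * \<alpha> * x p = 1\<close>, and \<open>x\<close> would have the same sign at
      \<open>i\<close> and \<open>j\<close>.\<close>
    have "\<beta> \<noteq> 0"
    proof
      assume "\<beta> = 0"
      moreover have mem: "i \<in> A" "i \<in> C" "j \<in> B" "j \<in> C"
        using ij by blast+
      ultimately have "0 < \<alpha> * x i" "0 < \<alpha> * x j"
        using on_C[of i] on_C[of j] by (simp_all add: ab x_def)
      then show False
        using neg[OF mem(1)] pos[OF mem(3)] by (simp add: zero_less_mult_iff)
    qed
    \<comment> \<open>Solves \<open>D m c = \<alpha> *\<^sub>R u + \<beta> *\<^sub>R w\<close>: the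
      coefficient of \<open>w\<close> gives \<open>c\<close>, then that of \<open>u\<close> gives
      \<open>m\<close>.\<close>
    define m c where "m = - \<alpha> / \<beta>" and "c = 1 / (2 * \<beta>)"
    have c: "c \<noteq> 0"
      using \<open>\<beta> \<noteq> 0\<close> by (simp add: c_def)
    have "z - v = D m c"
      using \<open>\<beta> \<noteq> 0\<close> by (simp add: ab D_def m_def c_def algebra_simps)
    then have z: "z = v + D m c" and r': "r = norm (D m c)"
      using r by (auto simp: algebra_simps)
    have on: "card {i\<in>A. y i - m * x i = c} = 1" "card {i\<in>B. y i - m * x i = c} = 1"
      using on_Int[of A c m] on_Int[of B c m] c C[unfolded H_def] zr(2) z r' by auto
    have S: "S = insert v (A \<union> B)"
      using AB v by auto
    have "{i\<in>A \<union> B. c < y i - m * x i} = (if 0 < c then S \<inter> ball z r else S - cball z r)"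
      using less[OF _ c, of _ m] le[OF _ c, of _ m] on_v[of m c]
      unfolding z r' by (auto simp: S)
    then have "card {i\<in>A \<union> B. c < y i - m * x i} = n - 1"
      using zr by simp
    then show "C \<in> \<Phi> ` L"
      using on zr(2) z r' by (intro image_eqI[of _ _ "(m, c)"]) (auto simp: \<Phi>_def L_def)
  qed
  then show "finite H" and "card H = min (card A) (card B)"
    using L bij_betw_finite bij_betw_same_card by metis+
qed

section \<open>Ranks, middle points and the final sum\<close>

text \<open>From \<open>n\<close> to \<open>Suc n\<close>, the two end terms vanish and each of the
  \<open>2 * n + 1\<close> inner terms is one more than an old term.\<close>

lemma sum_min_complement: "(\<Sum>i\<le>2 * n. min i (2 * n - i)) = n ^ 2" for n :: nat
proof (induction n)
  case (Suc n)
  have "(\<Sum>i\<le>2 * Suc n. min i (2 * Suc n - i)) = (\<Sum>i\<le>Suc (2 * n). min (Suc i) (2 * Suc n - Suc i))"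
    using sum.atMost_Suc_shift[of "\<lambda>i. min i (2 * Suc n - i)" "Suc (2 * n)"] by simp
  also have "\<dots> = (\<Sum>i\<le>2 * n. min (Suc i) (2 * Suc n - Suc i))"
    by simp
  also have "\<dots> = (\<Sum>i\<le>2 * n. min i (2 * n - i) + 1)"
    by (intro sum.cong) auto
  also have "\<dots> = Suc n ^ 2"
    by (simp only: sum.distrib Suc.IH) (simp add: power2_eq_square)
  finally show ?case .
qed simp

lemma bij_betw_rank:
  fixes f :: "'a \<Rightarrow> 'b::linorder"
  assumes "finite S" "inj_on f S"
  shows "bij_betw (\<lambda>v. card {p\<in>S. f p < f v}) S {..<card S}"
proof -
  have less: "card {p\<in>S. f p < f v} < card {p\<in>S. f p < f v'}"
    if "v \<in> S" "f v < f v'" for v v'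
    using that assms(1) by (intro psubset_card_mono) auto
  have inj: "inj_on (\<lambda>v. card {p\<in>S. f p < f v}) S"
  proof (rule inj_onI)
    fix v v' assume v: "v \<in> S" "v' \<in> S" "card {p\<in>S. f p < f v} = card {p\<in>S. f p < f v'}"
    then have "f v = f v'"
      using less[of v v'] less[of v' v] by (cases "f v" "f v'" rule: linorder_cases) auto
    then show "v = v'"
      using v inj_onD[OF assms(2)] by blast
  qed
  moreover have "(\<lambda>v. card {p\<in>S. f p < f v}) ` S \<subseteq> {..<card S}"
    using assms(1) by (auto intro!: psubset_card_mono)
  ultimately show ?thesis
    using card_subset_eq[of "{..<card S}" "(\<lambda>v. card {p\<in>S. f p < f v}) ` S"]
    by (simp add: bij_betw_def card_image)
qed

text \<open>The middle element is the one of rank 1; trichotomy leaves one element above it.\<close>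

lemma ex_middle:
  fixes f :: "'a \<Rightarrow> 'b::linorder"
  assumes "card T = 3" "inj_on f T"
  obtains v where "v \<in> T" "card {p\<in>T. f p < f v} = 1" "card {p\<in>T. f v < f p} = 1"
proof -
  have fin: "finite T"
    by (intro card_ge_0_finite) (simp add: assms(1))
  obtain v where v: "v \<in> T" "card {p\<in>T. f p < f v} = 1"
    using bij_betw_imp_surj_on[OF bij_betw_rank[OF fin assms(2)]] assms(1)
    by (metis (no_types, lifting) imageE lessThan_iff one_less_numeral_iff semiring_norm(77))
  have "{p\<in>T. f p = f v} = {v}"
    using v(1) inj_onD[OF assms(2)] by blast
  then show ?thesis
    using card_trichotomy[OF fin, of "f v" f] v assms(1) that by simp
qed

lemma middle_unique:
  fixes f :: "'a \<Rightarrow> 'b::linorder"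
  assumes "finite T" "inj_on f T" "v \<in> T" "v' \<in> T"
    "card {p\<in>T. f p < f v} = card {p\<in>T. f p < f v'}"
  shows "v = v'"
  using inj_onD[OF bij_betw_imp_inj_on[OF bij_betw_rank[OF assms(1,2)]] assms(5)] assms(3,4) by blast

theorem theorem1:
  fixes n :: nat and S :: "(real ^ 2) set"
  assumes "n \<ge> 1"
    and "card S = 2 * n + 1"
    and "general_position S"
  shows "card {C. halving_circle n S C} = n ^ 2"
proof -
  have finS: "finite S"
    by (intro card_ge_0_finite) (simp add: assms(2))
  obtain u w where u: "inj_on (\<lambda>p. p \<bullet> u) S" and w: "\<And>m. w - m *\<^sub>R u \<noteq> 0"
    and span: "\<And>D. \<exists>\<alpha> \<beta>. D = \<alpha> *\<^sub>R u + \<beta> *\<^sub>R w"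
    using exists_generic_basis[OF finS] by blast
  define A where "A v = {p\<in>S. p \<bullet> u < v \<bullet> u}" for v
  define B where "B v = {p\<in>S. v \<bullet> u < p \<bullet> u}" for v
  define H where "H v = {C. halving_circle n S C \<and> v \<in> C \<and> card (A v \<inter> C) = 1 \<and> card (B v \<inter> C) = 1}" for v
  have H: "finite (H v)" "card (H v) = min (card (A v)) (2 * n - card (A v))" if "v \<in> S" for v
  proof -
    have "{p\<in>S. p \<bullet> u = v \<bullet> u} = {v}"
      using that inj_onD[OF u] by blast
    then have "card (B v) = 2 * n - card (A v)"
      using card_trichotomy[OF finS, of "v \<bullet> u" "\<lambda>p. p \<bullet> u"] assms(2) by (simp add: A_def B_def)
    then show "finite (H v)" "card (H v) = min (card (A v)) (2 * n - card (A v))"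
      using card_halving_circles_middle[OF assms(3,1,2) u w span that, folded A_def B_def, folded H_def]
      by simp_all
  qed
  \<comment> \<open>Turns membership in \<open>H v\<close> into the statement that \<open>v\<close>
    is the middle one of the points of \<open>S \<inter> C\<close>, so that every halving circle
    lies in exactly one \<open>H v\<close>.\<close>
  have sub: "A v \<inter> C = {p\<in>S \<inter> C. p \<bullet> u < v \<bullet> u}" "B v \<inter> C = {p\<in>S \<inter> C. v \<bullet> u < p \<bullet> u}" for v C
    by (auto simp: A_def B_def)
  have injC: "inj_on (\<lambda>p. p \<bullet> u) (S \<inter> C)" for C
    using u by (rule inj_on_subset) auto
  have "halving_circle n S C \<Longrightarrow> \<exists>v\<in>S. C \<in> H v" for C
  proof -
    assume C: "halving_circle n S C"
    then have "card (S \<inter> C) = 3"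
      by (auto simp: halving_circle_def)
    then obtain v where "v \<in> S \<inter> C" "card (A v \<inter> C) = 1" "card (B v \<inter> C) = 1"
      unfolding sub using injC by (rule ex_middle)
    then show ?thesis
      using C by (auto simp: H_def)
  qed
  then have "{C. halving_circle n S C} = (\<Union>v\<in>S. H v)"
    by (auto simp: H_def)
  moreover have "card (\<Union>v\<in>S. H v) = (\<Sum>v\<in>S. card (H v))"
  proof (rule card_UN_disjoint')
    show "disjoint_family_on H S"
      unfolding disjoint_family_on_def
    proof (intro ballI impI, rule ccontr)
      fix v v' assume v: "v \<in> S" "v' \<in> S" "v \<noteq> v'" "H v \<inter> H v' \<noteq> {}"
      then obtain C where "C \<in> H v" "C \<in> H v'"
        by blast
      then have "v = v'"
        using v finS unfolding H_def sub by (intro middle_unique[OF _ injC[of C]]) auto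
      then show False
        using v by simp
    qed
  qed (use finS H in auto)
  \<comment> \<open>\<open>card (A v)\<close> is the rank of \<open>v\<close>, which takes each
    value from 0 to \<open>2 * n\<close> once.\<close>
  moreover have "(\<Sum>v\<in>S. card (H v)) = (\<Sum>i<card S. min i (2 * n - i))"
    using H(2) bij_betw_rank[OF finS u]
    by (subst sum.reindex_bij_betw[symmetric]) (auto simp: A_def)
  ultimately show ?thesis
    using sum_min_complement[of n] assms(2) by (simp add: lessThan_Suc_atMost)
qed

end
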